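(* Let $\Gamma$ be a subgroup of $\mathrm{Homeo}_{+}(I)$, $I=[0,1]$, generated by finitely many homeomorphisms $f_1,\ldots,f_s$, and let $\epsilon>0$. Then there exist $g_1,\ldots,g_s\in\mathrm{Homeo}_{+}(I)$ such that $\max_{1\le i\le s}\|g_i-f_i\|<\epsilon$ and, moreover, the subgroup $\Gamma_1$ of $\mathrm{Homeo}_{+}(I)$ generated by $g_1,\ldots,g_s$ is $C_0$-strongly discrete and $\Gamma_1$ is isomorphic to $\Gamma$.
   Context: $\mathrm{Homeo}_{+}(I)$ is the group of orientation preserving homeomorphisms of $I=[0,1]$. For $f\in C[0,1]$, $\|f\|=\max_{x\in[0,1]}|f(x)|$. A subgroup $\Gamma\le\mathrm{Homeo}_{+}(I)$ is called $C_0$-strongly discrete if there exist $\delta>0$ and $x_0\in(0,1)$ such that $|g(x_0)-x_0|>\delta$ for all $g\in\Gamma\setminus\{1\}$. *)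

theory Defs
  imports "HOL-Analysis.Analysis" "HOL-Algebra.Algebra"
begin

(* Self-maps of I = [0,1] are represented by the extensional functions of BijGroup, so that
   equality of functions is equality on I.  An orientation preserving homeomorphism of an
   interval is one that preserves its order. *)
definition Homeo_plus :: "(real \<Rightarrow> real) monoid" where
  "Homeo_plus = BijGroup {0..1}
     \<lparr>carrier := {f \<in> Bij {0..1}. (\<exists>f'. homeomorphism {0..1} {0..1} f f') \<and> strict_mono_on {0..1} f}\<rparr>"

(* The supremum is attained, hence a maximum, for every f continuous on [0,1]; it is only
   used for such f. *)
definition C0_norm :: "(real \<Rightarrow> real) \<Rightarrow> real" where
  "C0_norm f = (SUP x\<in>{0..1}. \<bar>f x\<bar>)"

definition C0_strongly_discrete :: "(real \<Rightarrow> real) set \<Rightarrow> bool" where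
  "C0_strongly_discrete \<Gamma> \<longleftrightarrow>
     subgroup \<Gamma> Homeo_plus \<and>
     (\<exists>\<delta>>0. \<exists>x\<^sub>0\<in>{0<..<1}. \<forall>g\<in>\<Gamma> - {\<one>\<^bsub>Homeo_plus\<^esub>}. \<bar>g x\<^sub>0 - x\<^sub>0\<bar> > \<delta>)"

lemma subgroup_Homeo_plus: "subgroup (carrier Homeo_plus) (BijGroup {0..1})"
proof -
  let ?I = "{0..1::real}"
  have C: "carrier Homeo_plus =
      {f \<in> Bij ?I. (\<exists>f'. homeomorphism ?I ?I f f') \<and> strict_mono_on ?I f}"
    by (simp add: Homeo_plus_def)
  show ?thesis
  proof (rule group.subgroupI[OF group_BijGroup])
    show "carrier Homeo_plus \<subseteq> carrier (BijGroup ?I)"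
      by (auto simp: C BijGroup_def)
    have "homeomorphism ?I ?I (\<lambda>x\<in>?I. x) (\<lambda>x. x)"
      by (rule homeomorphism_cong[OF homeomorphism_ident]) auto
    moreover have "strict_mono_on ?I (\<lambda>x\<in>?I. x)"
      by (auto simp: strict_mono_on_def)
    ultimately show "carrier Homeo_plus \<noteq> {}"
      using id_Bij[of ?I] unfolding C by blast
  next
    fix f assume "f \<in> carrier Homeo_plus"
    then obtain f' where f: "f \<in> Bij ?I" and h: "homeomorphism ?I ?I f f'"
      and m: "strict_mono_on ?I f" by (auto simp: C)
    define k where "k = (\<lambda>x\<in>?I. inv_into ?I f x)"
    have inj: "inj_on f ?I" using f by (simp add: Bij_def bij_betw_def)
    have fk: "f' y \<in> ?I \<and> f (f' y) = y \<and> k y = f' y" if "y \<in> ?I" for y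
    proof -
      have a: "f' y \<in> ?I" "f (f' y) = y" using h that by (auto simp: homeomorphism_def)
      then have "inv_into ?I f y = f' y" using inv_into_f_f[OF inj a(1)] by simp
      then show ?thesis using a that by (simp add: k_def)
    qed
    have "homeomorphism ?I ?I k f"
      by (rule homeomorphism_cong[OF homeomorphism_symD[OF h]]) (use fk in auto)
    moreover have "strict_mono_on ?I k"
    proof (rule strict_mono_onI)
      fix x y assume xy: "x \<in> ?I" "y \<in> ?I" "x < y"
      show "k x < k y"
      proof (rule ccontr)
        assume "\<not> k x < k y"
        then have "f (k y) \<le> f (k x)"
          using strict_mono_on_leD[OF m, of "k y" "k x"] fk xy by simp
        then show False using fk xy by simp
      qed
    qed
    moreover have "k \<in> Bij ?I" unfolding k_def using f by (rule restrict_inv_into_Bij)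
    ultimately show "inv\<^bsub>BijGroup ?I\<^esub> f \<in> carrier Homeo_plus"
      using inv_BijGroup[OF f] unfolding C k_def by auto
  next
    fix f g assume "f \<in> carrier Homeo_plus" "g \<in> carrier Homeo_plus"
    then obtain f' g' where f: "f \<in> Bij ?I" "homeomorphism ?I ?I f f'" "strict_mono_on ?I f"
      and g: "g \<in> Bij ?I" "homeomorphism ?I ?I g g'" "strict_mono_on ?I g" by (auto simp: C)
    have gI: "g x \<in> ?I" if "x \<in> ?I" for x using g(2) that by (auto simp: homeomorphism_def)
    have "homeomorphism ?I ?I (compose ?I f g) (g' \<circ> f')"
      by (rule homeomorphism_cong[OF homeomorphism_compose[OF g(2) f(2)]]) (auto simp: compose_def)
    moreover have "strict_mono_on ?I (compose ?I f g)"
      using f(3) g(3) gI unfolding strict_mono_on_def compose_def by simp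
    moreover have "compose ?I f g \<in> Bij ?I" using f g by (intro compose_Bij)
    ultimately show "f \<otimes>\<^bsub>BijGroup ?I\<^esub> g \<in> carrier Homeo_plus"
      using f g unfolding C by (auto simp: BijGroup_def)
  qed
qed

lemma group_Homeo_plus: "group Homeo_plus"
  using group.subgroup_imp_group[OF group_BijGroup subgroup_Homeo_plus]
  by (simp add: Homeo_plus_def)

end

theory Submission
  imports Defs
begin

text \<open>
The idea is a Denjoy blow-up of one orbit that makes the action of \<open>\<Gamma>\<close> on the inserted gaps free.
Fix \<open>p = 1/2\<close>. The group of orientation preserving homeomorphisms carries a left-invariant linear
order \<open>\<lless>\<close> with \<open>h p < k p \<Longrightarrow> h \<lless> k\<close>: compare the values at \<open>p\<close> and then, lexicographically, along a
dense sequence (\<open>exists_left_order\<close>). Insert into the interval one gap for every element \<open>h\<close> of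
\<open>\<Gamma>\<close>, located at \<open>h p\<close>; if several elements have the same value at \<open>p\<close>, their gaps are placed
there side by side in the order \<open>\<lless>\<close>. So the stabiliser of \<open>p\<close> is allowed to be nontrivial, and yet
\<open>\<Gamma>\<close> permutes the gaps freely by left multiplication, which preserves their order.

As \<open>\<Gamma>\<close> is countable, the gaps can be given positive lengths \<open>w h\<close> with a total \<open>W\<close> as small as one
likes; the old interval is shrunk by the factor \<open>1 - W\<close> to make room. The old points and the
interior points of the gaps together, called marks, have coordinates that form a dense subset of
\<open>[0,1]\<close> (\<open>coord_dense\<close>), on which \<open>\<Gamma>\<close> acts preserving the order. Such an action extends uniquely to
an action by homeomorphisms (\<open>extend_order_preserving_action\<close>), giving a homomorphism \<open>\<Psi>\<close>
into \<open>Homeo_plus\<close>, and \<open>g\<^sub>i = \<Psi> f\<^sub>i\<close>.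

No mark has moved further than \<open>W\<close> from its original position, so by uniform continuity of the
finitely many \<open>f\<^sub>i\<close> the \<open>g\<^sub>i\<close> are close to the \<open>f\<^sub>i\<close> (\<open>realization_close\<close>). Let \<open>x\<^sub>0\<close> be the
midpoint of the gap of the identity. A nontrivial \<open>g\<close> takes it to the midpoint of the gap of \<open>g\<close>,
which is disjoint from the gap of the identity; hence every nontrivial \<open>\<Psi> g\<close> moves \<open>x\<^sub>0\<close> by more
than half of \<open>w \<one>\<close>. This gives strong discreteness, and also the injectivity of \<open>\<Psi>\<close>.
\<close>

section \<open>Monotone maps of the unit interval\<close>

lemma mono_fixing_dense_eq:
  fixes F :: "real \<Rightarrow> real"
  assumes mono: "mono_on {0..1} F" and ran: "F \<in> {0..1} \<rightarrow> {0..1}"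
    and sub: "M \<subseteq> {0..1}"
    and dense: "\<And>a b. 0 \<le> a \<Longrightarrow> a < b \<Longrightarrow> b \<le> 1 \<Longrightarrow> \<exists>m\<in>M. a < m \<and> m < b"
    and fixed: "\<And>m. m \<in> M \<Longrightarrow> F m = m" and x: "x \<in> {0..1}"
  shows "F x = x"
proof (rule ccontr)
  assume "F x \<noteq> x"
  moreover have Fx: "F x \<in> {0..1}" using ran x by auto
  ultimately consider "x < F x" | "F x < x" by linarith
  then show False
  proof cases
    case 1
    then obtain m where "m \<in> M" "x < m" "m < F x" using dense[of x "F x"] x Fx by auto
    then show False using mono_onD[OF mono x, of m] sub fixed[of m] by auto
  next
    case 2
    then obtain m where "m \<in> M" "F x < m" "m < x" using dense[of "F x" x] x Fx by auto
    then show False using mono_onD[OF mono _ x, of m] sub fixed[of m] by auto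
  qed
qed

text \<open>A monotone map with an open image is continuous. The image \<open>[0,1]\<close> is not open, but extending the
map by the identity gives a monotone surjection of the whole line.\<close>

lemma continuous_on_mono_surj:
  fixes F :: "real \<Rightarrow> real"
  assumes mono: "mono_on {0..1} F" and surj: "F ` {0..1} = {0..1}"
  shows "continuous_on {0..1} F"
proof -
  define E where "E x = (if x \<in> {0..1} then F x else x)" for x
  have ran: "F x \<in> {0..1}" if "x \<in> {0..1}" for x using surj that by auto
  have "y \<in> range E" for y
  proof (cases "y \<in> {0..1}")
    case True
    then obtain x where "x \<in> {0..1}" "y = F x" using surj by (metis imageE)
    then have "y = E x" by (simp add: E_def)
    then show ?thesis by blast
  next
    case False
    then have "y = E y" by (simp only: E_def if_False)
    then show ?thesis by blast
  qed
  then have "range E = UNIV" by blast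
  moreover have "E x \<le> E y" if "x \<le> y" for x y
    using that ran[of x] ran[of y] mono_onD[OF mono, of x y] by (auto simp: E_def)
  ultimately have "continuous_on UNIV E" by (intro continuous_onI_mono) auto
  then have "continuous_on {0..1} E" by (rule continuous_on_subset) auto
  then show ?thesis by (rule continuous_on_eq) (simp add: E_def)
qed

section \<open>Orientation preserving homeomorphisms\<close>

lemma carrier_Homeo_plus:
  "carrier Homeo_plus =
     {f \<in> Bij {0..1}. (\<exists>f'. homeomorphism {0..1} {0..1} f f') \<and> strict_mono_on {0..1} f}"
  by (simp add: Homeo_plus_def)

lemma mult_Homeo_plus:
  "f \<in> carrier Homeo_plus \<Longrightarrow> g \<in> carrier Homeo_plus \<Longrightarrow>
     f \<otimes>\<^bsub>Homeo_plus\<^esub> g = compose {0..1} f g"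
  by (auto simp: Homeo_plus_def BijGroup_def)

lemma one_Homeo_plus: "\<one>\<^bsub>Homeo_plus\<^esub> = (\<lambda>x\<in>{0..1}. x)"
  by (simp add: Homeo_plus_def BijGroup_def)

lemma Homeo_plusD:
  assumes "f \<in> carrier Homeo_plus"
  shows "strict_mono_on {0..1} f" "f ` {0..1} = {0..1}" "continuous_on {0..1} f"
    "f \<in> extensional {0..1}"
  using assms by (auto simp: carrier_Homeo_plus Bij_def homeomorphism_def)

lemma Homeo_plus_less_iff:
  assumes "f \<in> carrier Homeo_plus" "x \<in> {0..1}" "y \<in> {0..1}"
  shows "f x < f y \<longleftrightarrow> x < y" "f x \<le> f y \<longleftrightarrow> x \<le> y" "f x = f y \<longleftrightarrow> x = y"
  using strict_mono_on_less[OF Homeo_plusD(1)[OF assms(1)]]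
    strict_mono_on_less_eq[OF Homeo_plusD(1)[OF assms(1)]]
    strict_mono_on_eq[OF Homeo_plusD(1)[OF assms(1)]] assms(2,3) by auto

lemma Homeo_plus_in_I: "f \<in> carrier Homeo_plus \<Longrightarrow> x \<in> {0..1} \<Longrightarrow> f x \<in> {0..1}"
  using Homeo_plusD(2) by blast

lemma mono_inverse_pair_Homeo_plus:
  fixes F F' :: "real \<Rightarrow> real"
  assumes "mono_on {0..1} F" "F \<in> {0..1} \<rightarrow> {0..1}"
    and "mono_on {0..1} F'" "F' \<in> {0..1} \<rightarrow> {0..1}"
    and inv: "\<And>x. x \<in> {0..1} \<Longrightarrow> F' (F x) = x" "\<And>x. x \<in> {0..1} \<Longrightarrow> F (F' x) = x"
  shows "restrict F {0..1} \<in> carrier Homeo_plus"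
proof -
  have "G ` {0..1} = {0..1}"
    if "G \<in> {0..1} \<rightarrow> {0..1}" "G' \<in> {0..1} \<rightarrow> {0..1}" "\<And>x. x \<in> {0..1} \<Longrightarrow> G (G' x) = x"
    for G G' :: "real \<Rightarrow> real"
  proof (intro equalityI image_subsetI subsetI)
    fix x :: real assume "x \<in> {0..1}"
    then show "G x \<in> {0..1}" "x \<in> G ` {0..1}"
      using that funcset_mem[OF that(2)] by (auto intro!: image_eqI[of x G "G' x"])
  qed
  note surj = this[OF assms(2,4) inv(2)] this[OF assms(4,2) inv(1)]
  have "homeomorphism {0..1} {0..1} F F'"
    using continuous_on_mono_surj surj assms by (auto simp: homeomorphism_def)
  then have "homeomorphism {0..1} {0..1} (restrict F {0..1}) F'"
    by (rule homeomorphism_cong) auto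
  moreover have inj: "inj_on F {0..1}" using inv(1) by (rule inj_on_inverseI)
  then have "restrict F {0..1} \<in> Bij {0..1}"
    using surj by (auto simp: Bij_def bij_betw_def inj_on_def)
  moreover have "strict_mono_on {0..1} (restrict F {0..1})"
  proof (rule strict_mono_onI)
    fix x y :: real assume xy: "x \<in> {0..1}" "y \<in> {0..1}" "x < y"
    then have "F x \<le> F y" "F x \<noteq> F y"
      using mono_onD[OF assms(1), of x y] inj_onD[OF inj, of x y] by auto
    then show "restrict F {0..1} x < restrict F {0..1} y" using xy by simp
  qed
  ultimately show ?thesis by (auto simp: carrier_Homeo_plus)
qed

text \<open>An order preserving group action on a dense subset of \<open>[0,1]\<close> extends to an action by
homeomorphisms. Every element is extended by suprema to a monotone map; as a monotone map that
fixes a dense set is the identity, the extensions inherit all the relations of the group, in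
particular the extensions of \<open>g\<close> and \<open>inv g\<close> are mutually inverse and so are homeomorphisms.\<close>

lemma extend_order_preserving_action:
  fixes G :: "('g, 'b) monoid_scheme" (structure) and \<phi> :: "'q \<Rightarrow> real"
  assumes "group G"
    and act: "\<And>g q. g \<in> carrier G \<Longrightarrow> q \<in> Q \<Longrightarrow> act g q \<in> Q"
    and act_one: "\<And>q. q \<in> Q \<Longrightarrow> act \<one>\<^bsub>G\<^esub> q = q"
    and act_mult: "\<And>g h q. g \<in> carrier G \<Longrightarrow> h \<in> carrier G \<Longrightarrow> q \<in> Q \<Longrightarrow>
                     act (g \<otimes>\<^bsub>G\<^esub> h) q = act g (act h q)"
    and ran: "\<phi> ` Q \<subseteq> {0..1}"
    and dense: "\<And>a b. 0 \<le> a \<Longrightarrow> a < b \<Longrightarrow> b \<le> 1 \<Longrightarrow> \<exists>q\<in>Q. a < \<phi> q \<and> \<phi> q < b"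
    and mono: "\<And>g q r. g \<in> carrier G \<Longrightarrow> q \<in> Q \<Longrightarrow> r \<in> Q \<Longrightarrow> \<phi> q \<le> \<phi> r \<Longrightarrow>
                 \<phi> (act g q) \<le> \<phi> (act g r)"
  obtains \<Psi> where "\<Psi> \<in> hom G Homeo_plus"
    "\<And>g q. g \<in> carrier G \<Longrightarrow> q \<in> Q \<Longrightarrow> \<Psi> g (\<phi> q) = \<phi> (act g q)"
proof -
  interpret group G by fact
  let ?I = "{0..1::real}"
  \<comment> \<open>The element 0 keeps the supremum meaningful at points with no value of \<open>\<phi>\<close> below them.\<close>
  define A where "A g t = insert 0 ((\<lambda>q. \<phi> (act g q)) ` {q \<in> Q. \<phi> q \<le> t})" for g t
  define F where "F g t = Sup (A g t)" for g t
  have A_sub: "A g t \<subseteq> ?I" if "g \<in> carrier G" for g t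
    using act[OF that] ran by (auto simp: A_def)
  have bdd: "bdd_above (A g t)" if "g \<in> carrier G" for g t
    by (rule bdd_above_mono[OF _ A_sub[OF that]]) simp
  have F_ran: "F g \<in> ?I \<rightarrow> ?I" if g: "g \<in> carrier G" for g
  proof
    fix t
    have "F g t \<le> 1" unfolding F_def
    proof (rule cSup_least)
      show "A g t \<noteq> {}" by (simp add: A_def)
      show "x \<le> 1" if "x \<in> A g t" for x using subsetD[OF A_sub[OF g] that] by simp
    qed
    moreover have "0 \<le> F g t" unfolding F_def
      by (rule cSup_upper) (use bdd[OF g] in \<open>auto simp: A_def\<close>)
    ultimately show "F g t \<in> ?I" by simp
  qed
  have F_mono: "mono_on ?I (F g)" if g: "g \<in> carrier G" for g
    unfolding F_def
    by (intro mono_onI cSup_subset_mono bdd g) (auto simp: A_def)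
  have F_act: "F g (\<phi> q) = \<phi> (act g q)" if g: "g \<in> carrier G" and q: "q \<in> Q" for g q
    unfolding F_def
  proof (rule cSup_eq_maximum)
    show "\<phi> (act g q) \<in> A g (\<phi> q)" using q by (auto simp: A_def)
    show "x \<le> \<phi> (act g q)" if "x \<in> A g (\<phi> q)" for x
      using that mono[OF g _ q] act[OF g q] ran by (auto simp: A_def)
  qed
  have F_inv: "F (inv g) (F g x) = x" if g: "g \<in> carrier G" and x: "x \<in> ?I" for g x
  proof (rule mono_fixing_dense_eq[where M = "\<phi> ` Q" and F = "\<lambda>x. F (inv g) (F g x)"])
    show "mono_on ?I (\<lambda>x. F (inv g) (F g x))"
      using F_mono[OF g] F_mono[of "inv g"] F_ran[OF g] g
      by (auto simp: mono_on_def Pi_iff)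
    show "(\<lambda>x. F (inv g) (F g x)) \<in> ?I \<rightarrow> ?I"
      using F_ran[OF g] F_ran[of "inv g"] g by (auto simp: Pi_iff)
    show "F (inv g) (F g m) = m" if "m \<in> \<phi> ` Q" for m
      using that g by (auto simp: F_act act simp flip: act_mult) (simp add: act_one)
  qed (use ran dense x in auto)
  have F_inv': "F g (F (inv g) x) = x" if "g \<in> carrier G" "x \<in> ?I" for g x
    using F_inv[of "inv g" x] that by simp
  have F_mult: "F (g \<otimes>\<^bsub>G\<^esub> h) x = F g (F h x)"
    if g: "g \<in> carrier G" and h: "h \<in> carrier G" and x: "x \<in> ?I" for g h x
  proof -
    let ?k = "inv (g \<otimes>\<^bsub>G\<^esub> h)"
    have k: "?k \<in> carrier G" using g h by simp
    have I: "F h y \<in> ?I" "F g (F h y) \<in> ?I" if "y \<in> ?I" for y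
      using F_ran[OF g] F_ran[OF h] that by blast+
    have "F ?k (F g (F h x)) = x"
    proof (rule mono_fixing_dense_eq[where M = "\<phi> ` Q" and F = "\<lambda>x. F ?k (F g (F h x))"])
      show "mono_on ?I (\<lambda>x. F ?k (F g (F h x)))"
        by (intro mono_onI mono_onD[OF F_mono[OF k]] mono_onD[OF F_mono[OF g]]
              mono_onD[OF F_mono[OF h]] I)
      show "(\<lambda>x. F ?k (F g (F h x))) \<in> ?I \<rightarrow> ?I"
        using F_ran[OF k] I(2) by blast
      show "F ?k (F g (F h m)) = m" if "m \<in> \<phi> ` Q" for m
        using that g h k by (auto simp: F_act act simp flip: act_mult)
          (simp add: act_one flip: m_assoc)
    qed (use ran dense x in auto)
    then show ?thesis using F_inv'[of "g \<otimes>\<^bsub>G\<^esub> h" "F g (F h x)"] g h I[OF x] by simp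
  qed
  define \<Psi> where "\<Psi> g = restrict (F g) ?I" for g
  have \<Psi>_carrier: "\<Psi> g \<in> carrier Homeo_plus" if "g \<in> carrier G" for g
    unfolding \<Psi>_def
    by (rule mono_inverse_pair_Homeo_plus[where F' = "F (inv g)"])
      (use that F_mono F_ran F_inv F_inv' in auto)
  have "\<Psi> \<in> hom G Homeo_plus"
  proof (rule homI)
    fix g h assume gh: "g \<in> carrier G" "h \<in> carrier G"
    moreover from this have "F h x \<in> ?I" if "x \<in> ?I" for x using F_ran[of h] that by blast
    ultimately have "\<Psi> (g \<otimes>\<^bsub>G\<^esub> h) = compose ?I (\<Psi> g) (\<Psi> h)"
      by (simp add: F_mult compose_def \<Psi>_def fun_eq_iff)
    then show "\<Psi> (g \<otimes>\<^bsub>G\<^esub> h) = \<Psi> g \<otimes>\<^bsub>Homeo_plus\<^esub> \<Psi> h"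
      using gh by (simp add: mult_Homeo_plus \<Psi>_carrier)
  qed (rule \<Psi>_carrier)
  moreover have "\<Psi> g (\<phi> q) = \<phi> (act g q)" if "g \<in> carrier G" "q \<in> Q" for g q
    using that ran F_act by (auto simp: \<Psi>_def)
  ultimately show ?thesis by (rule that)
qed

section \<open>A left-invariant linear order\<close>

definition lex_less :: "(nat \<Rightarrow> real) \<Rightarrow> (real \<Rightarrow> real) \<Rightarrow> (real \<Rightarrow> real) \<Rightarrow> bool" where
  "lex_less e h k \<longleftrightarrow> (\<exists>n. h (e n) < k (e n) \<and> (\<forall>m<n. h (e m) = k (e m)))"

lemma lex_less_irrefl: "\<not> lex_less e h h"
  by (simp add: lex_less_def)

lemma lex_less_trans:
  assumes "lex_less e h k" "lex_less e k l"
  shows "lex_less e h l"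
proof -
  obtain n where n: "h (e n) < k (e n)" "\<forall>m<n. h (e m) = k (e m)"
    using assms(1) by (auto simp: lex_less_def)
  obtain n' where n': "k (e n') < l (e n')" "\<forall>m<n'. k (e m) = l (e m)"
    using assms(2) by (auto simp: lex_less_def)
  have "h (e (min n n')) < l (e (min n n'))"
    using n n' by (cases n n' rule: linorder_cases) (auto simp: min_def)
  then show ?thesis unfolding lex_less_def using n n' by (intro exI[of _ "min n n'"]) auto
qed

lemma lex_less_total:
  assumes hk: "h \<in> carrier Homeo_plus" "k \<in> carrier Homeo_plus"
    and dense: "{0..1} \<subseteq> closure (range e)" and e: "range e \<subseteq> {0..1}" and "h \<noteq> k"
  shows "lex_less e h k \<or> lex_less e k h"
proof -
  have cl: "closure (range e) = {0..1}"
    using dense closure_minimal[OF e] by auto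
  have "\<exists>n. h (e n) \<noteq> k (e n)"
  proof (rule ccontr)
    assume eq: "\<nexists>n. h (e n) \<noteq> k (e n)"
    have "continuous_on (closure (range e)) (\<lambda>x. h x - k x)"
      unfolding cl by (intro continuous_on_diff hk[THEN Homeo_plusD(3)])
    then have "h x - k x = 0" if "x \<in> {0..1}" for x
      by (rule continuous_constant_on_closure) (use eq that cl in auto)
    then have "h = k"
      by (intro extensionalityI[OF Homeo_plusD(4)[OF hk(1)] Homeo_plusD(4)[OF hk(2)]]) auto
    with \<open>h \<noteq> k\<close> show False by contradiction
  qed
  then obtain n where "h (e n) \<noteq> k (e n)" "\<forall>m<n. h (e m) = k (e m)"
    using exists_least_iff[of "\<lambda>n. h (e n) \<noteq> k (e n)"] by auto
  then show ?thesis unfolding lex_less_def by (metis linorder_neqE)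
qed

lemma lex_less_left_invariant:
  assumes "g \<in> carrier Homeo_plus" "h \<in> carrier Homeo_plus" "k \<in> carrier Homeo_plus"
    and e: "range e \<subseteq> {0..1}" and "lex_less e h k"
  shows "lex_less e (g \<otimes>\<^bsub>Homeo_plus\<^esub> h) (g \<otimes>\<^bsub>Homeo_plus\<^esub> k)"
proof -
  obtain n where n: "h (e n) < k (e n)" "\<forall>m<n. h (e m) = k (e m)"
    using assms(5) by (auto simp: lex_less_def)
  have eI: "e m \<in> {0..1}" for m using e by blast
  have "g (h (e n)) < g (k (e n))"
    using n(1) Homeo_plus_less_iff(1)[OF assms(1)] Homeo_plus_in_I[OF assms(2) eI]
      Homeo_plus_in_I[OF assms(3) eI] by blast
  then show ?thesis unfolding lex_less_def
    using n(2) eI assms(1-3) by (intro exI[of _ n]) (auto simp: mult_Homeo_plus compose_eq)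
qed

text \<open>The order must refine the order of the values at \<open>p\<close>, so the lexicographic comparison starts at \<open>p\<close>
and continues along a dense sequence, which separates continuous maps.\<close>

lemma exists_left_order:
  fixes p :: real
  assumes p: "p \<in> {0..1}"
  obtains less :: "(real \<Rightarrow> real) \<Rightarrow> (real \<Rightarrow> real) \<Rightarrow> bool" where
    "\<And>h. \<not> less h h"
    "\<And>h k l. less h k \<Longrightarrow> less k l \<Longrightarrow> less h l"
    "\<And>h k. h \<in> carrier Homeo_plus \<Longrightarrow> k \<in> carrier Homeo_plus \<Longrightarrow> h \<noteq> k \<Longrightarrow> less h k \<or> less k h"
    "\<And>g h k. g \<in> carrier Homeo_plus \<Longrightarrow> h \<in> carrier Homeo_plus \<Longrightarrow> k \<in> carrier Homeo_plus \<Longrightarrow>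
       less h k \<Longrightarrow> less (g \<otimes>\<^bsub>Homeo_plus\<^esub> h) (g \<otimes>\<^bsub>Homeo_plus\<^esub> k)"
    "\<And>h k. h p < k p \<Longrightarrow> less h k"
proof -
  obtain D where D: "countable D" "D \<subseteq> {0..1::real}" "{0..1} \<subseteq> closure D"
    using separable by metis
  then have "D \<noteq> {}" by auto
  define e where "e = case_nat p (from_nat_into D)"
  have e0: "e 0 = p" by (simp add: e_def)
  have "range e = insert p D"
  proof -
    have "range e = insert (e 0) (range (\<lambda>n. e (Suc n)))"
      by (auto simp: image_iff) (metis not0_implies_Suc)
    then show ?thesis by (simp add: e_def range_from_nat_into[OF \<open>D \<noteq> {}\<close> D(1)])
  qed
  then have e: "range e \<subseteq> {0..1}" "{0..1} \<subseteq> closure (range e)"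
    using D p closure_mono[of D "insert p D"] by auto
  show ?thesis
  proof (rule that[of "lex_less e"])
    show "\<not> lex_less e h h" for h by (rule lex_less_irrefl)
    show "lex_less e h l" if "lex_less e h k" "lex_less e k l" for h k l
      using that by (rule lex_less_trans)
    show "lex_less e h k \<or> lex_less e k h"
      if "h \<in> carrier Homeo_plus" "k \<in> carrier Homeo_plus" "h \<noteq> k" for h k
      using that e by (intro lex_less_total)
    show "lex_less e (g \<otimes>\<^bsub>Homeo_plus\<^esub> h) (g \<otimes>\<^bsub>Homeo_plus\<^esub> k)"
      if "g \<in> carrier Homeo_plus" "h \<in> carrier Homeo_plus" "k \<in> carrier Homeo_plus"
        "lex_less e h k" for g h k
      using that e(1) by (intro lex_less_left_invariant)
    show "lex_less e h k" if "h p < k p" for h k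
      using that e0 by (auto simp: lex_less_def intro!: exI[of _ 0])
  qed
qed

section \<open>Countability, weights and moduli of continuity\<close>

text \<open>Bracketed products of generators and their inverses, of nesting depth at most \<open>n\<close>, form countable
sets \<open>W n\<close> that exhaust the generated subgroup.\<close>

lemma countable_generate:
  assumes "countable H"
  shows "countable (generate G H)"
proof -
  define B where "B = insert \<one>\<^bsub>G\<^esub> (H \<union> (\<lambda>h. inv\<^bsub>G\<^esub> h) ` H)"
  define W where "W = rec_nat B (\<lambda>_ Y. Y \<union> (\<lambda>(a, b). a \<otimes>\<^bsub>G\<^esub> b) ` (Y \<times> Y))"
  have W_simps: "W 0 = B" "W (Suc n) = W n \<union> (\<lambda>(a, b). a \<otimes>\<^bsub>G\<^esub> b) ` (W n \<times> W n)" for n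
    by (simp_all add: W_def)
  have mono: "W n \<subseteq> W m" if "n \<le> m" for n m
    by (rule lift_Suc_mono_le[OF _ that]) (auto simp: W_simps)
  have "countable (W n)" for n
    by (induction n) (use assms in \<open>auto simp: W_simps B_def\<close>)
  then have "countable (\<Union>n. W n)" by simp
  moreover have "generate G H \<subseteq> (\<Union>n. W n)"
  proof
    fix x assume "x \<in> generate G H"
    then show "x \<in> (\<Union>n. W n)"
    proof induction
      case (eng a b)
      then obtain n m where "a \<in> W n" "b \<in> W m" by blast
      then have "a \<in> W (max n m)" "b \<in> W (max n m)"
        using mono by (meson max.cobounded1 max.cobounded2 subsetD)+
      then have "a \<otimes>\<^bsub>G\<^esub> b \<in> W (Suc (max n m))" by (auto simp: W_simps)
      then show ?case by blast
    qed (auto intro!: exI[of _ 0] simp: W_simps B_def)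
  qed
  ultimately show ?thesis by (rule countable_subset[rotated])
qed

lemma exists_small_weights:
  fixes A :: "'a set" and c :: real
  assumes "countable A" "c > 0"
  obtains w where "\<And>h. h \<in> A \<Longrightarrow> w h > 0" "w summable_on A" "infsum w A \<le> c"
proof -
  define v where "v n = c * (1/2) ^ Suc n" for n
  have v_pos: "v n > 0" for n using assms(2) by (simp add: v_def)
  have "v sums (c * 1)" unfolding v_def by (intro sums_mult power_half_series)
  then have v: "(v has_sum c) UNIV"
    using v_pos by (intro norm_summable_imp_has_sum) (auto simp: sums_iff less_imp_le)
  define N where "N = to_nat_on A ` A"
  have v_N: "v summable_on N"
    using has_sum_imp_summable[OF v] by (rule summable_on_subset_banach) simp
  have inj: "inj_on (to_nat_on A) A" using assms(1) by (rule inj_on_to_nat_on)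
  show ?thesis
  proof (rule that[of "v \<circ> to_nat_on A"])
    show "v \<circ> to_nat_on A summable_on A"
      using v_N unfolding N_def summable_on_reindex[OF inj] .
    have "infsum v N \<le> infsum v UNIV"
      using v_N has_sum_imp_summable[OF v] v_pos by (intro infsum_mono2) (auto intro: less_imp_le)
    then show "infsum (v \<circ> to_nat_on A) A \<le> c"
      unfolding N_def infsum_reindex[OF inj] infsumI[OF v] .
  qed (simp add: v_pos)
qed

lemma common_modulus:
  fixes f :: "'i \<Rightarrow> real \<Rightarrow> real"
  assumes "finite J" "\<And>i. i \<in> J \<Longrightarrow> continuous_on {0..1} (f i)" "\<eta> > 0"
  obtains d where "d > 0"
    "\<And>i x y. i \<in> J \<Longrightarrow> x \<in> {0..1} \<Longrightarrow> y \<in> {0..1} \<Longrightarrow> \<bar>x - y\<bar> < d \<Longrightarrow> \<bar>f i x - f i y\<bar> < \<eta>"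
proof -
  have "\<exists>d>0. \<forall>x\<in>{0..1}. \<forall>y\<in>{0..1}. \<bar>x - y\<bar> < d \<longrightarrow> \<bar>f i x - f i y\<bar> < \<eta>" if "i \<in> J" for i
    using compact_uniformly_continuous[OF assms(2)[OF that] compact_Icc] assms(3)
    unfolding uniformly_continuous_on_def dist_real_def by (metis abs_minus_commute)
  then obtain D where D: "\<And>i. i \<in> J \<Longrightarrow> D i > 0"
    "\<And>i x y. i \<in> J \<Longrightarrow> x \<in> {0..1} \<Longrightarrow> y \<in> {0..1} \<Longrightarrow> \<bar>x - y\<bar> < D i \<Longrightarrow> \<bar>f i x - f i y\<bar> < \<eta>"
    by metis
  show ?thesis
  proof (rule that[of "Min (insert 1 (D ` J))"])
    show "Min (insert 1 (D ` J)) > 0" using D(1) assms(1) by simp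
  qed (use D(2) assms(1) in simp)
qed

section \<open>Blowing up an orbit into gaps indexed by the group\<close>

text \<open>The points whose positions in the blown-up interval are prescribed: \<open>Pt y\<close> is the old point \<open>y\<close>, and
\<open>Gap h t\<close> is the interior point with relative position \<open>t\<close> of the gap indexed by \<open>h\<close>.\<close>

datatype mark = Pt real | Gap "real \<Rightarrow> real" real

text \<open>The data of the blow-up: the base point \<open>p\<close>, the order \<open>\<lless>\<close> in which the gaps are arranged, and
their lengths \<open>w\<close>. Left invariance of \<open>\<lless>\<close> makes the permutation of the gaps order preserving, and the
compatibility of \<open>\<lless>\<close> with the values at \<open>p\<close> makes it possible to place the gap of \<open>h\<close> at \<open>h p\<close>.\<close>

locale orbit_blow_up =
  fixes \<Gamma> :: "(real \<Rightarrow> real) set" and p :: real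
    and less :: "(real \<Rightarrow> real) \<Rightarrow> (real \<Rightarrow> real) \<Rightarrow> bool" (infix \<open>\<lless>\<close> 50)
    and w :: "(real \<Rightarrow> real) \<Rightarrow> real"
  assumes \<Gamma>: "subgroup \<Gamma> Homeo_plus" and p: "p \<in> {0<..<1}"
    and irrefl: "\<not> h \<lless> h"
    and trans: "h \<lless> k \<Longrightarrow> k \<lless> l \<Longrightarrow> h \<lless> l"
    and total: "h \<in> \<Gamma> \<Longrightarrow> k \<in> \<Gamma> \<Longrightarrow> h \<noteq> k \<Longrightarrow> h \<lless> k \<or> k \<lless> h"
    and left_inv: "g \<in> \<Gamma> \<Longrightarrow> h \<in> \<Gamma> \<Longrightarrow> k \<in> \<Gamma> \<Longrightarrow> h \<lless> k \<Longrightarrow>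
                     g \<otimes>\<^bsub>Homeo_plus\<^esub> h \<lless> g \<otimes>\<^bsub>Homeo_plus\<^esub> k"
    and base: "h p < k p \<Longrightarrow> h \<lless> k"
    and w_pos: "h \<in> \<Gamma> \<Longrightarrow> w h > 0"
    and w_summable: "w summable_on \<Gamma>"
    and w_small: "infsum w \<Gamma> < 1"
begin

lemma \<Gamma>_carrier: "h \<in> \<Gamma> \<Longrightarrow> h \<in> carrier Homeo_plus"
  using subgroup.subset[OF \<Gamma>] by blast

lemma \<Gamma>_mult: "g \<in> \<Gamma> \<Longrightarrow> h \<in> \<Gamma> \<Longrightarrow> g \<otimes>\<^bsub>Homeo_plus\<^esub> h \<in> \<Gamma>"
  by (rule subgroup.m_closed[OF \<Gamma>])

lemma \<Gamma>_one: "\<one>\<^bsub>Homeo_plus\<^esub> \<in> \<Gamma>"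
  by (rule subgroup.one_closed[OF \<Gamma>])

lemma \<Gamma>_mult_p: "g \<in> \<Gamma> \<Longrightarrow> h \<in> \<Gamma> \<Longrightarrow> (g \<otimes>\<^bsub>Homeo_plus\<^esub> h) p = g (h p)"
  using p by (simp add: mult_Homeo_plus \<Gamma>_carrier compose_eq)

lemma orbit_in_I: "h \<in> \<Gamma> \<Longrightarrow> h p \<in> {0<..<1}"
proof -
  assume h: "h \<in> \<Gamma>"
  note less = Homeo_plus_less_iff(1)[OF \<Gamma>_carrier[OF h]] and I = Homeo_plus_in_I[OF \<Gamma>_carrier[OF h]]
  have "h 0 < h p" "h p < h 1" using p by (simp_all add: less)
  then show ?thesis using I[of 0] I[of 1] by simp
qed

lemma base_le: "h \<in> \<Gamma> \<Longrightarrow> k \<in> \<Gamma> \<Longrightarrow> h \<lless> k \<Longrightarrow> h p \<le> k p"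
  using base irrefl trans by (meson linorder_not_le)

subsection \<open>Total lengths of sets of gaps\<close>

abbreviation W :: real where "W \<equiv> infsum w \<Gamma>"

definition S :: "(real \<Rightarrow> real) set \<Rightarrow> real" where "S A = infsum w (\<Gamma> \<inter> A)"

lemma summable_Int: "w summable_on (\<Gamma> \<inter> A)"
  using w_summable by (rule summable_on_subset_banach) auto

lemma S_mono:
  assumes "\<And>h. h \<in> \<Gamma> \<Longrightarrow> h \<in> A \<Longrightarrow> h \<in> B"
  shows "S A \<le> S B"
  unfolding S_def by (rule infsum_mono2) (use assms w_pos in \<open>auto intro: summable_Int less_imp_le\<close>)

lemma S_nonneg: "0 \<le> S A"
  unfolding S_def by (rule infsum_nonneg) (use w_pos in \<open>auto intro: less_imp_le\<close>)

lemma S_UNIV: "S UNIV = W"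
  by (simp add: S_def)

lemma S_le_W: "S A \<le> W"
  using S_mono[of A UNIV] by (simp add: S_UNIV)

lemma S_Compl: "S A + S (- A) = W"
proof -
  have "infsum w (\<Gamma> \<inter> A \<union> \<Gamma> \<inter> - A) = S A + S (- A)"
    unfolding S_def by (intro infsum_Un_disjoint summable_Int) auto
  moreover have "\<Gamma> \<inter> A \<union> \<Gamma> \<inter> - A = \<Gamma>" by auto
  ultimately show ?thesis by simp
qed

lemma S_insert:
  assumes "h \<in> \<Gamma>" "h \<notin> A"
  shows "S (insert h A) = S A + w h"
proof -
  have "infsum w ((\<Gamma> \<inter> A) \<union> {h}) = S A + infsum w {h}"
    unfolding S_def using assms(2) by (intro infsum_Un_disjoint summable_Int) auto
  moreover have "(\<Gamma> \<inter> A) \<union> {h} = \<Gamma> \<inter> insert h A" using assms by auto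
  ultimately show ?thesis by (simp add: S_def)
qed

lemma S_finite_le: "finite F \<Longrightarrow> F \<subseteq> \<Gamma> \<inter> A \<Longrightarrow> sum w F \<le> S A"
  unfolding S_def
  by (rule finite_sum_le_infsum) (use w_pos in \<open>auto intro: summable_Int less_imp_le\<close>)

lemma W_nonneg: "0 \<le> W"
  using S_nonneg[of UNIV] by (simp add: S_UNIV)

subsection \<open>Marks and their coordinates\<close>

text \<open>The left endpoint of the gap of \<open>h\<close>: the shrunken old position plus the lengths of all gaps to its left.\<close>

definition start :: "(real \<Rightarrow> real) \<Rightarrow> real" where
  "start h = (1 - W) * h p + S {k. k \<lless> h}"

text \<open>The gaps located at an old point \<open>y\<close> are placed to its right, whence the strict inequality in the
first clause. They consist of open intervals in \<open>marks\<close>, so that \<open>y\<close> does not collide with the first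
of them.\<close>

fun coord :: "mark \<Rightarrow> real" where
  "coord (Pt y) = (1 - W) * y + S {k. k p < y}"
| "coord (Gap h t) = start h + t * w h"

text \<open>The position before the blow-up.\<close>

fun foot :: "mark \<Rightarrow> real" where
  "foot (Pt y) = y"
| "foot (Gap h t) = h p"

fun act :: "(real \<Rightarrow> real) \<Rightarrow> mark \<Rightarrow> mark" where
  "act g (Pt y) = Pt (g y)"
| "act g (Gap h t) = Gap (g \<otimes>\<^bsub>Homeo_plus\<^esub> h) t"

definition marks :: "mark set" where
  "marks = Pt ` {0..1} \<union> {Gap h t | h t. h \<in> \<Gamma> \<and> t \<in> {0<..<1}}"

lemma Gap_marks: "h \<in> \<Gamma> \<Longrightarrow> 0 < t \<Longrightarrow> t < 1 \<Longrightarrow> Gap h t \<in> marks"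
  by (auto simp: marks_def)

text \<open>The order of the marks, described without reference to lengths. It is visibly preserved by \<open>act\<close>,
and \<open>coord\<close> turns it into the order of the reals.\<close>

fun before :: "mark \<Rightarrow> mark \<Rightarrow> bool" where
  "before (Pt y) (Pt z) \<longleftrightarrow> y < z"
| "before (Pt y) (Gap h t) \<longleftrightarrow> y \<le> h p"
| "before (Gap h t) (Pt y) \<longleftrightarrow> h p < y"
| "before (Gap h t) (Gap k u) \<longleftrightarrow> h \<lless> k \<or> (h = k \<and> t < u)"

lemma before_total: "q \<in> marks \<Longrightarrow> r \<in> marks \<Longrightarrow> q \<noteq> r \<Longrightarrow> before q r \<or> before r q"
  using total by (cases q; cases r) (fastforce simp: marks_def)+

text \<open>The right endpoint of a gap, computed from the lengths to its left or from those to its right.\<close>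

lemma start_finish:
  assumes "h \<in> \<Gamma>"
  shows "start h + w h = (1 - W) * h p + S (insert h {k. k \<lless> h})"
    "start h + w h = (1 - W) * h p + W - S {k. h \<lless> k}"
proof -
  show *: "start h + w h = (1 - W) * h p + S (insert h {k. k \<lless> h})"
    using S_insert[OF assms, of "{k. k \<lless> h}"] irrefl by (simp add: start_def)
  have "S (- insert h {k. k \<lless> h}) = S {k. h \<lless> k}"
    using total[OF assms] irrefl trans by (intro antisym S_mono) blast+
  then show "start h + w h = (1 - W) * h p + W - S {k. h \<lless> k}"
    using * S_Compl[of "insert h {k. k \<lless> h}"] by simp
qed

lemma gap_bounds:
  assumes "h \<in> \<Gamma>" "t \<in> {0<..<1}"
  shows "start h < coord (Gap h t)" "coord (Gap h t) < start h + w h"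
  using w_pos[OF assms(1)] assms(2) by auto

lemma scale_mono: "y \<le> z \<Longrightarrow> (1 - W) * y \<le> (1 - W) * z" "y < z \<Longrightarrow> (1 - W) * y < (1 - W) * z"
  using w_small by auto

lemma finish_le_start:
  assumes "h \<in> \<Gamma>" "k \<in> \<Gamma>" "h \<lless> k"
  shows "start h + w h \<le> start k"
proof -
  have "S (insert h {l. l \<lless> h}) \<le> S {l. l \<lless> k}"
    using assms(3) trans by (intro S_mono) auto
  then show ?thesis
    using start_finish(1)[OF assms(1)] start_def[of k] scale_mono(1)[OF base_le[OF assms]]
    by linarith
qed

lemma coord_before:
  assumes "q \<in> marks" "r \<in> marks" "before q r"
  shows "coord q < coord r"
proof (cases q)
  case q: (Pt y)
  show ?thesis
  proof (cases r)
    case r: (Pt z)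
    then have "y < z" using assms q by simp
    then have "S {k. k p < y} \<le> S {k. k p < z}" by (intro S_mono) auto
    then show ?thesis using scale_mono(2)[OF \<open>y < z\<close>] q r by simp
  next
    case r: (Gap h t)
    then have h: "h \<in> \<Gamma>" "t \<in> {0<..<1}" "y \<le> h p" using assms q by (auto simp: marks_def)
    then have "S {k. k p < y} \<le> S {k. k \<lless> h}" using base by (intro S_mono) auto
    then have "coord q \<le> start h" using scale_mono(1)[OF h(3)] q by (simp add: start_def)
    then show ?thesis using gap_bounds(1)[OF h(1,2)] r by simp
  qed
next
  case q: (Gap h t)
  then have h: "h \<in> \<Gamma>" "t \<in> {0<..<1}" using assms by (auto simp: marks_def)
  show ?thesis
  proof (cases r)
    case r: (Pt y)
    then have "h p < y" using assms q by simp
    then have "S (insert h {k. k \<lless> h}) \<le> S {k. k p < y}"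
      using base_le[OF _ h(1)] by (intro S_mono) fastforce
    then have "start h + w h \<le> coord r"
      using scale_mono(2)[OF \<open>h p < y\<close>] r by (simp add: start_finish(1)[OF h(1)])
    then show ?thesis using gap_bounds(2)[OF h] q by simp
  next
    case r: (Gap k u)
    then have k: "k \<in> \<Gamma>" "u \<in> {0<..<1}" using assms by (auto simp: marks_def)
    show ?thesis
    proof (cases "h = k")
      case True
      then have "t < u" using assms q r irrefl by auto
      then show ?thesis using q r True w_pos[OF h(1)] by simp
    next
      case False
      then have "h \<lless> k" using assms q r by auto
      then show ?thesis
        using finish_le_start[OF h(1) k(1)] gap_bounds(2)[OF h] gap_bounds(1)[OF k] q r by simp
    qed
  qed
qed

lemma act_marks: "g \<in> \<Gamma> \<Longrightarrow> q \<in> marks \<Longrightarrow> act g q \<in> marks"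
  using Homeo_plus_in_I[OF \<Gamma>_carrier] \<Gamma>_mult by (auto simp: marks_def)

lemma foot_in_I: "q \<in> marks \<Longrightarrow> foot q \<in> {0..1}"
  using orbit_in_I by (auto simp: marks_def less_imp_le)

lemma foot_act: "g \<in> \<Gamma> \<Longrightarrow> q \<in> marks \<Longrightarrow> foot (act g q) = g (foot q)"
  using \<Gamma>_mult_p by (auto simp: marks_def)

lemma before_act:
  assumes "g \<in> \<Gamma>" "q \<in> marks" "r \<in> marks" "before q r"
  shows "before (act g q) (act g r)"
proof -
  have *: "h p \<in> {0..1}" if "h \<in> \<Gamma>" for h using orbit_in_I[OF that] by simp
  show ?thesis
    using assms Homeo_plus_less_iff[OF \<Gamma>_carrier[OF assms(1)]] * left_inv
    by (cases q; cases r) (auto simp: marks_def \<Gamma>_mult_p)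
qed

lemma coord_act_mono:
  assumes "g \<in> \<Gamma>" "q \<in> marks" "r \<in> marks" "coord q \<le> coord r"
  shows "coord (act g q) \<le> coord (act g r)"
proof (cases "q = r")
  case False
  then have "before q r"
    using before_total assms coord_before[of r q] by fastforce
  then show ?thesis
    using coord_before before_act act_marks assms by (meson less_imp_le)
qed simp

lemma act_one: "q \<in> marks \<Longrightarrow> act \<one>\<^bsub>Homeo_plus\<^esub> q = q"
  using monoid.l_one[OF group.is_monoid[OF group_Homeo_plus] \<Gamma>_carrier]
  by (auto simp: marks_def one_Homeo_plus)

lemma act_mult:
  assumes "g \<in> \<Gamma>" "h \<in> \<Gamma>" "q \<in> marks"
  shows "act (g \<otimes>\<^bsub>Homeo_plus\<^esub> h) q = act g (act h q)"
  using assms monoid.m_assoc[OF group.is_monoid[OF group_Homeo_plus]] \<Gamma>_carrier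
  by (auto simp: marks_def mult_Homeo_plus[of g h] compose_eq) (simp flip: mult_Homeo_plus)

lemma coord_foot:
  assumes "q \<in> marks"
  shows "(1 - W) * foot q \<le> coord q" "coord q \<le> (1 - W) * foot q + W"
proof -
  have "(1 - W) * foot q \<le> coord q \<and> coord q \<le> (1 - W) * foot q + W"
  proof (cases q)
    case (Pt y)
    then show ?thesis using S_nonneg S_le_W by simp
  next
    case (Gap h t)
    then have h: "h \<in> \<Gamma>" "t \<in> {0<..<1}" using assms by (auto simp: marks_def)
    show ?thesis
      using gap_bounds[OF h] start_finish(1)[OF h(1)] S_nonneg[of "{k. k \<lless> h}"]
        S_le_W[of "insert h {k. k \<lless> h}"] Gap by (simp add: start_def)
  qed
  then show "(1 - W) * foot q \<le> coord q" "coord q \<le> (1 - W) * foot q + W" by auto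
qed

lemma coord_in_I: "q \<in> marks \<Longrightarrow> coord q \<in> {0..1}"
proof -
  assume q: "q \<in> marks"
  have "0 \<le> (1 - W) * foot q" "(1 - W) * foot q \<le> 1 - W"
    using foot_in_I[OF q] w_small mult_left_le[of "foot q" "1 - W"] by auto
  then show ?thesis using coord_foot[OF q] by auto
qed

text \<open>
The shrinking moves a point to the left by at most \<open>W\<close>, the gaps push it to the right by at most \<open>W\<close>.
\<close>

lemma coord_near_foot:
  assumes "q \<in> marks"
  shows "\<bar>coord q - foot q\<bar> \<le> W"
proof -
  have "0 \<le> W * foot q" "W * foot q \<le> W"
    using foot_in_I[OF assms] W_nonneg mult_left_le[of "foot q" W] by auto
  then show ?thesis using coord_foot[OF assms] by (simp add: algebra_simps abs_le_iff)
qed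

subsection \<open>Density of the coordinates\<close>

lemma finite_has_last:
  assumes "finite F" "F \<subseteq> \<Gamma>" "F \<noteq> {}"
  shows "\<exists>h\<in>F. F \<subseteq> insert h {k. k \<lless> h}"
  using assms(1,3,2)
proof (induction rule: finite_ne_induct)
  case (insert x F)
  then obtain h where "h \<in> F" "F \<subseteq> insert h {k. k \<lless> h}" by auto
  then show ?case using total[of x h] insert trans by (cases "x = h") blast+
qed auto

lemma finite_has_first:
  assumes "finite F" "F \<subseteq> \<Gamma>" "F \<noteq> {}"
  shows "\<exists>h\<in>F. F \<subseteq> insert h {k. h \<lless> k}"
  using assms(1,3,2)
proof (induction rule: finite_ne_induct)
  case (insert x F)
  then obtain h where "h \<in> F" "F \<subseteq> insert h {k. h \<lless> k}" by auto
  then show ?case using total[of x h] insert trans by (cases "x = h") blast+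
qed auto

text \<open>This and the next lemma say that the old points and the gaps on one side of a cut together leave
no room at the cut: a common bound on their coordinates bounds the old length on that side plus
the total length of the gaps there. The total length is approached by finite sets of gaps. All gaps of a finite set
precede its last one (follow its first one, respectively), so the outer endpoint of that gap
already accounts for the lengths of all of them.\<close>

lemma mass_below:
  assumes "coord (Pt z) \<le> a" "\<And>h. h \<in> L \<Longrightarrow> start h + w h \<le> a" "L \<subseteq> \<Gamma>"
  shows "(1 - W) * z + S L \<le> a"
proof -
  have "sum w F \<le> a - (1 - W) * z" if F: "finite F" "F \<subseteq> L" for F
  proof (cases "F = {}")
    case True
    then show ?thesis using assms(1) S_nonneg[of "{k. k p < z}"] by simp
  next
    case False
    then obtain h where h: "h \<in> F" "F \<subseteq> insert h {k. k \<lless> h}"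
      using finite_has_last F assms(3) by (metis subset_trans)
    have F\<Gamma>: "F \<subseteq> \<Gamma>" using F assms(3) by blast
    show ?thesis
    proof (cases "h p < z")
      case True
      have "k p < z" if "k \<in> F" for k
        using base_le[of k h] that h F\<Gamma> True by (cases "k = h") fastforce+
      then have "F \<subseteq> \<Gamma> \<inter> {k. k p < z}" using F\<Gamma> by blast
      then have "sum w F \<le> S {k. k p < z}" by (rule S_finite_le[OF F(1)])
      then show ?thesis using assms(1) by simp
    next
      case False
      then have "(1 - W) * z \<le> (1 - W) * h p" by (intro scale_mono) simp
      moreover have "sum w F \<le> S (insert h {k. k \<lless> h})"
        using h F\<Gamma> by (intro S_finite_le F) auto
      moreover have "h \<in> L" "h \<in> \<Gamma>" using h F F\<Gamma> by auto
      ultimately show ?thesis using assms(2)[of h] start_finish(1)[of h] by linarith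
    qed
  qed
  then have "S L \<le> a - (1 - W) * z" unfolding S_def
    using infsum_le_finite_sums[OF summable_Int[of L]] assms(3) by (simp add: Int_absorb1)
  then show ?thesis by simp
qed

lemma mass_above:
  assumes "b \<le> coord (Pt z)" "\<And>h. h \<in> U \<Longrightarrow> b \<le> start h" "U \<subseteq> \<Gamma>"
  shows "b \<le> (1 - W) * z + W - S U"
proof -
  have "sum w F \<le> (1 - W) * z + W - b" if F: "finite F" "F \<subseteq> U" for F
  proof (cases "F = {}")
    case True
    then show ?thesis using assms(1) S_le_W[of "{k. k p < z}"] by simp
  next
    case False
    then obtain h where h: "h \<in> F" "F \<subseteq> insert h {k. h \<lless> k}"
      using finite_has_first F assms(3) by (metis subset_trans)
    have F\<Gamma>: "F \<subseteq> \<Gamma>" using F assms(3) by blast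
    show ?thesis
    proof (cases "h p < z")
      case False
      have "\<not> k p < z" if "k \<in> F" for k
        using base_le[of h k] that h F\<Gamma> False by (cases "k = h") fastforce+
      then have "F \<subseteq> \<Gamma> \<inter> - {k. k p < z}" using F\<Gamma> by blast
      then have "sum w F \<le> S (- {k. k p < z})" by (rule S_finite_le[OF F(1)])
      then show ?thesis using assms(1) S_Compl[of "{k. k p < z}"] by simp
    next
      case True
      then have "(1 - W) * h p \<le> (1 - W) * z" by (intro scale_mono) simp
      moreover have "sum w F \<le> S (insert h {k. h \<lless> k})"
        using h F\<Gamma> by (intro S_finite_le F) auto
      moreover have "S (insert h {k. h \<lless> k}) = S {k. h \<lless> k} + w h"
        using h F\<Gamma> irrefl by (intro S_insert) auto
      moreover have "h \<in> U" "h \<in> \<Gamma>" using h F F\<Gamma> by auto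
      ultimately show ?thesis using assms(2)[of h] start_finish(2)[of h] by linarith
    qed
  qed
  then have "S U \<le> (1 - W) * z + W - b" unfolding S_def
    using infsum_le_finite_sums[OF summable_Int[of U]] assms(3) by (simp add: Int_absorb1)
  then show ?thesis by simp
qed

text \<open>If there were no coordinate in \<open>(a, b)\<close>, every old point and every gap would lie either below \<open>a\<close> or
above \<open>b\<close>. The lengths of the parts below and above add up to at least 1, as the old points of both
kinds cover \<open>[0,1]\<close>. But below there is room for a length \<open>a\<close> only and above for \<open>1 - b\<close>.\<close>

lemma coord_dense:
  assumes ab: "0 \<le> a" "a < b" "b \<le> 1"
  shows "\<exists>q\<in>marks. a < coord q \<and> coord q < b"
proof (rule ccontr)
  assume "\<not> ?thesis"
  then have skip: "coord q \<le> a \<or> b \<le> coord q" if "q \<in> marks" for q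
    using that by force
  \<comment> \<open>A gap is connected, so it cannot have marks on both sides of \<open>(a, b)\<close>.\<close>
  have gaps: "start h + w h \<le> a \<or> b \<le> start h" if h: "h \<in> \<Gamma>" for h
  proof (rule ccontr)
    assume "\<not> ?thesis"
    then have "max a (start h) < min b (start h + w h)" using ab w_pos[OF h] by auto
    then obtain v where v: "max a (start h) < v" "v < min b (start h + w h)"
      using dense by blast
    define t where "t = (v - start h) / w h"
    have "t \<in> {0<..<1}" "coord (Gap h t) = v"
      using v w_pos[OF h] by (auto simp: t_def field_simps)
    then show False using skip[of "Gap h t"] h v by (auto simp: marks_def)
  qed
  define L where "L = {h \<in> \<Gamma>. start h + w h \<le> a}"
  define U where "U = \<Gamma> - L"
  have "S L + S U = W"
  proof -
    have "S U = S (- L)" by (intro antisym S_mono) (auto simp: U_def)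
    then show ?thesis using S_Compl[of L] by simp
  qed
  define Z where "Z = {z \<in> {0..1}. coord (Pt z) \<le> a}"
  define Z' where "Z' = {z \<in> {0..1}. b \<le> coord (Pt z)}"
  have Pt: "Pt z \<in> marks" if "z \<in> {0..1}" for z using that by (simp add: marks_def)
  have "coord (Pt 0) = 0"
  proof -
    have "S {k. k p < 0} = S {}" using orbit_in_I by (intro antisym S_mono) fastforce+
    then show ?thesis by (simp add: S_def)
  qed
  then have "0 \<in> Z" using ab by (simp add: Z_def)
  have "coord (Pt 1) = 1"
  proof -
    have "S {k. k p < 1} = S UNIV" using orbit_in_I by (intro antisym S_mono) fastforce+
    then show ?thesis by (simp add: S_UNIV)
  qed
  then have "1 \<in> Z'" using ab by (simp add: Z'_def)
  have bdd: "bdd_above Z" "bdd_below Z'" by (auto simp: Z_def Z'_def)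
  have below: "(1 - W) * z \<le> a - S L" if "z \<in> Z" for z
    using mass_below[of z a L] that by (auto simp: Z_def L_def)
  have above: "b - W + S U \<le> (1 - W) * z" if "z \<in> Z'" for z
  proof -
    have "b \<le> start h" if "h \<in> U" for h using that gaps by (auto simp: U_def L_def)
    moreover have "b \<le> coord (Pt z)" using that by (simp add: Z'_def)
    moreover have "U \<subseteq> \<Gamma>" by (auto simp: U_def)
    ultimately have "b \<le> (1 - W) * z + W - S U" by (intro mass_above)
    then show ?thesis by simp
  qed
  have "1 - W > 0" using w_small by simp
  have "(1 - W) * Sup Z \<le> a - S L"
  proof -
    have "Sup Z \<le> (a - S L) / (1 - W)"
      using below \<open>0 \<in> Z\<close> \<open>1 - W > 0\<close> by (intro cSup_least) (auto simp: field_simps)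
    then show ?thesis using \<open>1 - W > 0\<close> by (simp add: field_simps)
  qed
  moreover have "b - W + S U \<le> (1 - W) * Inf Z'"
  proof -
    have "(b - W + S U) / (1 - W) \<le> Inf Z'"
      using above \<open>1 \<in> Z'\<close> \<open>1 - W > 0\<close> by (intro cInf_greatest) (auto simp: field_simps)
    then show ?thesis using \<open>1 - W > 0\<close> by (simp add: field_simps)
  qed
  moreover have "Inf Z' \<le> Sup Z"
  proof (rule ccontr)
    assume "\<not> Inf Z' \<le> Sup Z"
    then obtain z where z: "Sup Z < z" "z < Inf Z'" using dense[of "Sup Z" "Inf Z'"] by auto
    moreover have "0 \<le> Sup Z" "Inf Z' \<le> 1"
      using cSup_upper[OF \<open>0 \<in> Z\<close> bdd(1)] cInf_lower[OF \<open>1 \<in> Z'\<close> bdd(2)] by auto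
    ultimately have "z \<in> {0..1}" by auto
    then have "z \<in> Z \<or> z \<in> Z'" using skip[OF Pt] by (auto simp: Z_def Z'_def)
    then show False using cSup_upper[OF _ bdd(1), of z] cInf_lower[OF _ bdd(2), of z] z by auto
  qed
  then have "(1 - W) * Inf Z' \<le> (1 - W) * Sup Z" by (rule scale_mono)
  ultimately show False using \<open>S L + S U = W\<close> ab by linarith
qed

subsection \<open>The new action\<close>

lemma realization:
  obtains \<Psi> where "\<Psi> \<in> hom (Homeo_plus\<lparr>carrier := \<Gamma>\<rparr>) Homeo_plus"
    "\<And>g q. g \<in> \<Gamma> \<Longrightarrow> q \<in> marks \<Longrightarrow> \<Psi> g (coord q) = coord (act g q)"
proof (rule extend_order_preserving_action[where G = "Homeo_plus\<lparr>carrier := \<Gamma>\<rparr>" and Q = marks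
        and act = act and \<phi> = coord])
  show "group (Homeo_plus\<lparr>carrier := \<Gamma>\<rparr>)"
    using group.subgroup_imp_group[OF group_Homeo_plus \<Gamma>] .
  show "coord ` marks \<subseteq> {0..1}" using coord_in_I by blast
qed (use act_marks act_one act_mult coord_dense coord_act_mono in \<open>auto intro: that\<close>)

text \<open>At a mark \<open>q\<close>, both \<open>coord q\<close> and the coordinate of its image are within \<open>W\<close> of the old positions \<open>foot q\<close>
and \<open>g (foot q)\<close>; density of the marks and continuity do the rest.\<close>

lemma realization_close:
  assumes \<Psi>: "\<Psi> \<in> carrier Homeo_plus"
    and act: "\<And>q. q \<in> marks \<Longrightarrow> \<Psi> (coord q) = coord (act g q)"
    and g: "g \<in> \<Gamma>"
    and modulus: "\<And>x y. x \<in> {0..1} \<Longrightarrow> y \<in> {0..1} \<Longrightarrow> \<bar>x - y\<bar> \<le> W \<Longrightarrow> \<bar>g x - g y\<bar> \<le> \<eta>"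
    and x: "x \<in> {0..1}"
  shows "\<bar>\<Psi> x - g x\<bar> \<le> W + \<eta>"
proof -
  have "{0..1} \<subseteq> closure (coord ` marks)"
  proof
    fix y :: real assume y: "y \<in> {0..1}"
    show "y \<in> closure (coord ` marks)" unfolding closure_approachable
    proof (intro allI impI)
      fix e :: real assume "e > 0"
      have "max 0 (y - e) < min 1 (y + e)" using y \<open>e > 0\<close> by auto
      then obtain q where "q \<in> marks" "max 0 (y - e) < coord q" "coord q < min 1 (y + e)"
        using coord_dense[of "max 0 (y - e)" "min 1 (y + e)"] by auto
      then show "\<exists>z\<in>coord ` marks. dist z y < e"
        by (intro bexI[of _ "coord q"]) (auto simp: dist_real_def)
    qed
  qed
  moreover have "closure (coord ` marks) \<subseteq> {0..1}"
    using coord_in_I by (intro closure_minimal) blast+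
  ultimately have cl: "closure (coord ` marks) = {0..1}" by blast
  show ?thesis
  proof (rule continuous_le_on_closure[of "coord ` marks" "\<lambda>x. \<bar>\<Psi> x - g x\<bar>"])
    show "continuous_on (closure (coord ` marks)) (\<lambda>x. \<bar>\<Psi> x - g x\<bar>)"
      unfolding cl using Homeo_plusD(3)[OF \<Psi>] Homeo_plusD(3)[OF \<Gamma>_carrier[OF g]]
      by (intro continuous_intros)
    show "\<bar>\<Psi> x - g x\<bar> \<le> W + \<eta>" if x: "x \<in> coord ` marks" for x
    proof -
      obtain q where q: "q \<in> marks" "x = coord q" using x by blast
      have "\<bar>coord (act g q) - g (foot q)\<bar> \<le> W"
        using coord_near_foot[OF act_marks[OF g q(1)]] foot_act[OF g q(1)] by simp
      moreover have "\<bar>g (foot q) - g (coord q)\<bar> \<le> \<eta>"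
        using modulus[OF foot_in_I coord_in_I] q(1) coord_near_foot[OF q(1)] by (simp add: abs_minus_commute)
      ultimately show ?thesis using act[OF q(1)] q(2) by simp
    qed
  qed (use x cl in auto)
qed

lemma gap_separation:
  assumes "g \<in> \<Gamma>" "h \<in> \<Gamma>" "g \<noteq> h"
  shows "\<bar>coord (Gap g (1/2)) - coord (Gap h (1/2))\<bar> > w h / 2"
proof -
  note w = w_pos[OF assms(1)] w_pos[OF assms(2)]
  from total[OF assms] show ?thesis
  proof
    assume "g \<lless> h"
    then have "start g + w g \<le> start h" using finish_le_start assms by blast
    then show ?thesis using w by simp
  next
    assume "h \<lless> g"
    then have "start h + w h \<le> start g" using finish_le_start assms by blast
    then show ?thesis using w by simp
  qed
qed

end

section \<open>Approximation by strongly discrete groups\<close>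

theorem theorem2p2:
  fixes \<Gamma> :: "(real \<Rightarrow> real) set"
    and f :: "nat \<Rightarrow> real \<Rightarrow> real"
    and s :: nat
    and \<epsilon> :: real
  assumes "subgroup \<Gamma> Homeo_plus"
    and "\<forall>i\<in>{1..s}. f i \<in> carrier Homeo_plus"
    and "\<Gamma> = generate Homeo_plus (f ` {1..s})"
    and "\<epsilon> > 0"
  shows "\<exists>g :: nat \<Rightarrow> real \<Rightarrow> real.
           (\<forall>i\<in>{1..s}. g i \<in> carrier Homeo_plus) \<and>
           (\<forall>i\<in>{1..s}. C0_norm (\<lambda>x. g i x - f i x) < \<epsilon>) \<and>
           (\<exists>\<Gamma>\<^sub>1. \<Gamma>\<^sub>1 = generate Homeo_plus (g ` {1..s}) \<and>
                 C0_strongly_discrete \<Gamma>\<^sub>1 \<and>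
                 Homeo_plus\<lparr>carrier := \<Gamma>\<^sub>1\<rparr> \<cong> Homeo_plus\<lparr>carrier := \<Gamma>\<rparr>)"
proof -
  let ?H = Homeo_plus and ?G = "Homeo_plus\<lparr>carrier := \<Gamma>\<rparr>"
  interpret H: group ?H by (rule group_Homeo_plus)
  have f_\<Gamma>: "f i \<in> \<Gamma>" if "i \<in> {1..s}" for i
    unfolding assms(3) using that by (auto intro: generate.incl)
  obtain d where d: "d > 0"
    "\<And>i x y. i \<in> {1..s} \<Longrightarrow> x \<in> {0..1} \<Longrightarrow> y \<in> {0..1} \<Longrightarrow> \<bar>x - y\<bar> < d \<Longrightarrow>
       \<bar>f i x - f i y\<bar> < \<epsilon> / 4"
    using common_modulus[of "{1..s}" f "\<epsilon> / 4"] assms(2,4) Homeo_plusD(3) by auto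
  \<comment> \<open>The total length \<open>c\<close> has to be less than 1, within the modulus \<open>d\<close>, and to leave a
    final error \<open>c + \<epsilon>/4\<close> below \<open>\<epsilon>\<close>.\<close>
  define c where "c = min (1/2) (min (d/2) (\<epsilon>/4))"
  have c: "0 < c" "c < 1" "c < d" "c \<le> \<epsilon>/4" using d(1) assms(4) by (auto simp: c_def min_def)
  have "countable \<Gamma>" unfolding assms(3) by (intro countable_generate countable_finite) simp
  then obtain w where w: "\<And>h. h \<in> \<Gamma> \<Longrightarrow> w h > 0" "w summable_on \<Gamma>" "infsum w \<Gamma> \<le> c"
    using exists_small_weights[of \<Gamma> c] c(1) by metis
  obtain less where less: "\<And>h. \<not> less h h"
    "\<And>h k l. less h k \<Longrightarrow> less k l \<Longrightarrow> less h l"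
    "\<And>h k. h \<in> carrier ?H \<Longrightarrow> k \<in> carrier ?H \<Longrightarrow> h \<noteq> k \<Longrightarrow> less h k \<or> less k h"
    "\<And>g h k. g \<in> carrier ?H \<Longrightarrow> h \<in> carrier ?H \<Longrightarrow> k \<in> carrier ?H \<Longrightarrow>
       less h k \<Longrightarrow> less (g \<otimes>\<^bsub>?H\<^esub> h) (g \<otimes>\<^bsub>?H\<^esub> k)"
    "\<And>h k. h (1/2) < k (1/2) \<Longrightarrow> less h k"
    by (rule exists_left_order[of "1/2"]) auto
  note \<Gamma>_sub = subsetD[OF subgroup.subset[OF assms(1)]]
  interpret orbit_blow_up \<Gamma> "1/2" less w
  proof (rule orbit_blow_up.intro)
    show "less h l" if "less h k" "less k l" for h k l using that by (rule less(2))
    show "less h k" if "h (1/2) < k (1/2)" for h k using that by (rule less(5))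
    show "less h k \<or> less k h" if "h \<in> \<Gamma>" "k \<in> \<Gamma>" "h \<noteq> k" for h k
      using that by (intro less(3) \<Gamma>_sub)
    show "less (g \<otimes>\<^bsub>?H\<^esub> h) (g \<otimes>\<^bsub>?H\<^esub> k)"
      if "g \<in> \<Gamma>" "h \<in> \<Gamma>" "k \<in> \<Gamma>" "less h k" for g h k
      using that by (intro less(4) \<Gamma>_sub)
    show "infsum w \<Gamma> < 1" using w(3) c(2) by simp
  qed (use assms(1) less(1) w(1,2) in simp_all)
  obtain \<Psi> where \<Psi>: "\<Psi> \<in> hom ?G ?H"
    and \<Psi>_coord: "\<And>g q. g \<in> \<Gamma> \<Longrightarrow> q \<in> marks \<Longrightarrow> \<Psi> g (coord q) = coord (act g q)"
    by (rule realization) (rule that)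
  interpret G: group ?G by (rule H.subgroup_imp_group[OF assms(1)])
  interpret \<Psi>: group_hom ?G ?H \<Psi> by unfold_locales (rule \<Psi>)
  have \<Psi>_H: "\<Psi> g \<in> carrier ?H" if "g \<in> \<Gamma>" for g using \<Psi>.hom_closed that by simp
  let ?e = "\<one>\<^bsub>?H\<^esub>" and ?m = "\<lambda>h. Gap h (1/2)"
  have m: "?m h \<in> marks" if "h \<in> \<Gamma>" for h using that by (simp add: Gap_marks)
  define x\<^sub>0 where "x\<^sub>0 = coord (?m ?e)"
  \<comment> \<open>\<open>x\<^sub>0\<close> lies strictly between two other marks of the same gap, so it is not an endpoint.\<close>
  have x\<^sub>0: "x\<^sub>0 \<in> {0<..<1}"
  proof -
    have q: "Gap ?e (1/4) \<in> marks" "Gap ?e (3/4) \<in> marks"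
      using \<Gamma>_one by (simp_all add: Gap_marks)
    have "coord (Gap ?e (1/4)) < x\<^sub>0" "x\<^sub>0 < coord (Gap ?e (3/4))"
      unfolding x\<^sub>0_def using w_pos[OF \<Gamma>_one] by simp_all
    then show ?thesis using coord_in_I[OF q(1)] coord_in_I[OF q(2)] by simp
  qed
  have moves: "\<bar>\<Psi> g x\<^sub>0 - x\<^sub>0\<bar> > w ?e / 2" if "g \<in> \<Gamma>" "g \<noteq> ?e" for g
  proof -
    have "\<Psi> g x\<^sub>0 = coord (?m g)"
      unfolding x\<^sub>0_def using \<Psi>_coord[OF that(1) m[OF \<Gamma>_one]] H.r_one[OF \<Gamma>_carrier[OF that(1)]]
      by simp
    then show ?thesis unfolding x\<^sub>0_def using gap_separation[OF that(1) \<Gamma>_one that(2)] by simp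
  qed
  define \<Gamma>\<^sub>1 where "\<Gamma>\<^sub>1 = \<Psi> ` \<Gamma>"
  have \<Gamma>\<^sub>1_gen: "\<Gamma>\<^sub>1 = generate ?H ((\<lambda>i. \<Psi> (f i)) ` {1..s})"
  proof -
    have sub: "f ` {1..s} \<subseteq> \<Gamma>" using f_\<Gamma> by blast
    have "generate ?H (\<Psi> ` f ` {1..s}) = \<Psi> ` generate ?G (f ` {1..s})"
      using sub by (intro \<Psi>.generate_img) simp
    also have "generate ?G (f ` {1..s}) = \<Gamma>"
      unfolding H.generate_consistent[OF sub assms(1)] by (rule assms(3)[symmetric])
    finally show ?thesis by (simp add: \<Gamma>\<^sub>1_def image_image)
  qed
  have "subgroup \<Gamma>\<^sub>1 ?H" using \<Psi>.img_is_subgroup by (simp add: \<Gamma>\<^sub>1_def)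
  have \<Psi>_one: "\<Psi> ?e = ?e" using \<Psi>.hom_one by simp
  have discrete: "C0_strongly_discrete \<Gamma>\<^sub>1"
    unfolding C0_strongly_discrete_def
  proof (intro conjI exI[of _ "w ?e / 2"] bexI[of _ x\<^sub>0] ballI)
    fix \<gamma> assume "\<gamma> \<in> \<Gamma>\<^sub>1 - {?e}"
    then obtain g where "g \<in> \<Gamma>" "\<gamma> = \<Psi> g" "g \<noteq> ?e" using \<Psi>_one by (auto simp: \<Gamma>\<^sub>1_def)
    then show "\<bar>\<gamma> x\<^sub>0 - x\<^sub>0\<bar> > w ?e / 2" using moves by simp
  qed (use \<open>subgroup \<Gamma>\<^sub>1 ?H\<close> x\<^sub>0 w_pos[OF \<Gamma>_one] in auto)
  have "inj_on \<Psi> \<Gamma>"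
  proof -
    have "g = ?e" if "g \<in> \<Gamma>" "\<Psi> g = ?e" for g
    proof (rule ccontr)
      assume "g \<noteq> ?e"
      then have "\<bar>?e x\<^sub>0 - x\<^sub>0\<bar> > w ?e / 2" using moves[OF that(1)] that(2) by simp
      then show False using x\<^sub>0 w_pos[OF \<Gamma>_one] by (simp add: one_Homeo_plus)
    qed
    then show ?thesis using \<Psi>.inj_on_one_iff by simp
  qed
  then have "\<Psi> \<in> iso ?G (?H\<lparr>carrier := \<Gamma>\<^sub>1\<rparr>)"
    using \<Psi> by (auto simp: iso_iff hom_def \<Gamma>\<^sub>1_def)
  then have iso: "?H\<lparr>carrier := \<Gamma>\<^sub>1\<rparr> \<cong> ?G" using G.iso_sym is_isoI by blast
  have close: "C0_norm (\<lambda>x. \<Psi> (f i) x - f i x) < \<epsilon>" if i: "i \<in> {1..s}" for i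
  proof -
    have "\<bar>\<Psi> (f i) x - f i x\<bar> \<le> infsum w \<Gamma> + \<epsilon> / 4" if "x \<in> {0..1}" for x
    proof (rule realization_close[OF \<Psi>_H _ f_\<Gamma>[OF i] _ that])
      show "\<bar>f i x - f i y\<bar> \<le> \<epsilon> / 4"
        if "x \<in> {0..1}" "y \<in> {0..1}" "\<bar>x - y\<bar> \<le> infsum w \<Gamma>" for x y
        using d(2)[OF i that(1,2)] that(3) w(3) c(3) by simp
    qed (use f_\<Gamma>[OF i] \<Psi>_coord in auto)
    then have "C0_norm (\<lambda>x. \<Psi> (f i) x - f i x) \<le> infsum w \<Gamma> + \<epsilon> / 4"
      unfolding C0_norm_def by (intro cSUP_least) auto
    then show ?thesis using w(3) c(4) assms(4) by simp
  qed
  show ?thesis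
    using \<Psi>_H f_\<Gamma> close \<Gamma>\<^sub>1_gen discrete iso
    by (intro exI[of _ "\<lambda>i. \<Psi> (f i)"]) blast
qed

end
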